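(* Let $s$ and $t$ be relatively prime positive integers and let $n$ be a positive integer. Then $a_{s,t}(n)$ equals the number of compositions of $n$ all of whose parts are congruent modulo $s+t$ to one of the numbers $r + \left\lceil \frac{rt+1}{s} \right\rceil$ with $0 \le r \le s-1$ (that is, for every part $p$ there is an integer $r$ with $0 \le r \le s-1$ and $p \equiv r + \left\lceil \frac{rt+1}{s} \right\rceil \pmod{s+t}$).
   Context: A composition of a positive integer $n$ is an ordered sequence $(c_1, \ldots, c_\ell)$ of positive integers, called parts, whose sum is $n$. For positive integers $s$ and $t$, $A_{s,t}(n)$ denotes the set of compositions $(c_1,\ldots,c_\ell)$ of $n$ that satisfy $s\, c_{2i-1} > t\, c_{2i}$ for every $i \ge 1$ with $2i \le \ell$ (if the number of parts $\ell$ is odd, no condition is imposed on the last part $c_\ell$). Put $a_{s,t}(n) = |A_{s,t}(n)|$. *)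

theory Defs
  imports Complex_Main "HOL-Number_Theory.Cong"
begin

definition compositions :: "nat \<Rightarrow> nat list set" where
  "compositions n = {c. (\<forall>p\<in>set c. 0 < p) \<and> sum_list c = n}"

(* Lists are indexed from 0, so the pair of parts (c_{2i-1}, c_{2i}) with 1 <= i and 2i <= l
   is (c ! (2 * j), c ! (2 * j + 1)) with j = i - 1. *)
definition A :: "nat \<Rightarrow> nat \<Rightarrow> nat \<Rightarrow> nat list set" where
  "A s t n = {c \<in> compositions n.
     \<forall>j. 2 * j + 1 < length c \<longrightarrow> s * c ! (2 * j) > t * c ! (2 * j + 1)}"

definition a :: "nat \<Rightarrow> nat \<Rightarrow> nat \<Rightarrow> nat" where
  "a s t n = card (A s t n)"

(* Both cardinalities of interest are cardinalities of subsets of this set. *)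
lemma finite_compositions: "finite (compositions n)"
proof (rule finite_subset)
  show "compositions n \<subseteq> {c. set c \<subseteq> {..n} \<and> length c \<le> n}"
  proof
    fix c assume c: "c \<in> compositions n"
    have "length c \<le> sum_list c" if "\<forall>p\<in>set c. 0 < p" for c :: "nat list"
      using that by (induction c) auto
    with c show "c \<in> {c. set c \<subseteq> {..n} \<and> length c \<le> n}"
      by (auto simp: compositions_def intro: member_le_sum_list)
  qed
  show "finite {c. set c \<subseteq> {..n} \<and> length c \<le> n}"
    by (rule finite_lists_length_le) simp
qed

end

theory Submission
  imports Defs
begin

text \<open>
  The theorem has a bijective proof, and the bijection works one pair of parts at a time.
  Fix \<open>y\<close>. The least \<open>x\<close> with \<open>s x > t y\<close> is \<open>\<lfloor>t y / s\<rfloor> + 1\<close>, so a pair \<open>(x, y)\<close> is admissible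
  exactly if it exceeds the tight pair \<open>(\<lfloor>t y / s\<rfloor> + 1, y)\<close> by some \<open>e \<ge> 0\<close> in its first entry.
  Replace it by \<open>e\<close> parts equal to 1 followed by the weight \<open>p\<^sub>y = y + \<lfloor>t y / s\<rfloor> + 1\<close> of the tight
  pair; replace a last part \<open>x\<close> without a partner by \<open>x\<close> parts equal to 1. As \<open>y\<close> runs through
  the positive integers, the \<open>p\<^sub>y\<close> are distinct and larger than \<open>1 = p\<^sub>0\<close>. Hence each part other
  than 1 marks the end of a pair and reveals its \<open>y\<close>, and nothing is lost: the compositions in
  \<open>A\<^sub>s\<^sub>,\<^sub>t(n)\<close> correspond to the compositions of \<open>n\<close> with all parts in \<open>{p\<^sub>k | k \<ge> 0}\<close>
  (\<open>bij_betw_assemble\<close>).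

  It remains to recognise this set of parts. Since \<open>\<lfloor>t r / s\<rfloor> + 1 = \<lceil>(r t + 1) / s\<rceil>\<close>, the numbers
  in the theorem are \<open>p\<^sub>0, \<dots>, p\<^bsub>s-1\<^esub>\<close>. They lie in \<open>{1..s + t}\<close>, and
  \<open>p\<^bsub>k+s\<^esub> = p\<^sub>k + (s + t)\<close>, so the positive integers in their residue classes modulo \<open>s + t\<close> are
  precisely all the \<open>p\<^sub>k\<close> (\<open>cong_iff_range_tight_weight\<close>).
\<close>

section \<open>Tight pairs and their weights\<close>

definition least_first :: "nat \<Rightarrow> nat \<Rightarrow> nat \<Rightarrow> nat" where
  "least_first s t y = t * y div s + 1"

definition tight_weight :: "nat \<Rightarrow> nat \<Rightarrow> nat \<Rightarrow> nat" where
  "tight_weight s t k = k + least_first s t k"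

lemma least_first_le_iff:
  assumes "s > 0"
  shows "least_first s t y \<le> x \<longleftrightarrow> t * y < s * x"
  using assms by (simp add: least_first_def Suc_le_eq div_less_iff_less_mult mult.commute)

lemma least_first_0 [simp]: "least_first s t 0 = 1"
  by (simp add: least_first_def)

lemma tight_weight_0 [simp]: "tight_weight s t 0 = 1"
  by (simp add: tight_weight_def)

lemma tight_weight_pos: "tight_weight s t k > 0"
  by (simp add: tight_weight_def least_first_def)

lemma strict_mono_tight_weight: "strict_mono (tight_weight s t)"
proof (rule strict_monoI)
  fix k l :: nat
  assume "k < l"
  then have "t * k div s \<le> t * l div s"
    by (intro div_le_mono mult_le_mono2) simp
  with \<open>k < l\<close> show "tight_weight s t k < tight_weight s t l"
    by (simp add: tight_weight_def least_first_def)
qed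

lemma inj_tight_weight: "inj (tight_weight s t)"
  using strict_mono_tight_weight by (rule strict_mono_imp_inj_on)

lemma tight_weight_add_mult:
  assumes "s > 0"
  shows "tight_weight s t (r + s * j) = tight_weight s t r + j * (s + t)"
proof -
  have "t * (r + s * j) div s = (t * r + s * (t * j)) div s"
    by (simp add: algebra_simps)
  also have "\<dots> = t * j + t * r div s"
    using assms by simp
  finally show ?thesis
    by (simp add: tight_weight_def least_first_def algebra_simps)
qed

lemma tight_weight_le_add:
  assumes "r < s"
  shows "tight_weight s t r \<le> s + t"
proof -
  have "s > 0"
    using assms by simp
  have "tight_weight s t r < tight_weight s t (0 + s * 1)"
    using assms strict_mono_tight_weight by (simp add: strict_mono_less)
  also have "\<dots> = 1 + (s + t)"
    unfolding tight_weight_add_mult[OF \<open>s > 0\<close>] by simp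
  finally show ?thesis
    by simp
qed

lemma ceiling_eq_least_first:
  assumes "s > 0"
  shows "\<lceil>(real r * real t + 1) / real s\<rceil> = int (least_first s t r)"
proof (rule ceiling_unique)
  let ?q = "t * r div s"
  have "s * ?q \<le> t * r"
    by simp
  then have "real s * real ?q \<le> real t * real r"
    by (metis of_nat_le_iff of_nat_mult)
  then show "of_int (int (least_first s t r)) - 1 < (real r * real t + 1) / real s"
    using assms by (simp add: least_first_def less_divide_eq mult.commute)
  have "t * r < s * least_first s t r"
    using least_first_le_iff[OF assms] by blast
  then have "real (t * r + 1) \<le> real (s * least_first s t r)"
    by (simp only: of_nat_le_iff)
  then show "(real r * real t + 1) / real s \<le> of_int (int (least_first s t r))"
    using assms by (simp add: divide_le_eq mult.commute)
qed

text \<open>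
  Positivity of \<open>p\<close> is what makes the residue classes start at the right place: the first \<open>s\<close>
  weights lie in the window \<open>{1..s + t}\<close>, so a positive member of such a class cannot lie
  below the weight that represents it.
\<close>

lemma cong_iff_range_tight_weight:
  assumes "s > 0" and "p > 0"
  shows "(\<exists>r<s. [int p = int r + \<lceil>(real r * real t + 1) / real s\<rceil>] (mod (int s + int t)))
    \<longleftrightarrow> p \<in> range (tight_weight s t)"
proof -
  have "[int p = int r + \<lceil>(real r * real t + 1) / real s\<rceil>] (mod (int s + int t))
      \<longleftrightarrow> [p = tight_weight s t r] (mod (s + t))" for r
    unfolding ceiling_eq_least_first[OF assms(1)] tight_weight_def
    by (simp flip: cong_int_iff)
  moreover have "(\<exists>r<s. [p = tight_weight s t r] (mod (s + t))) \<longleftrightarrow> p \<in> range (tight_weight s t)"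
  proof
    assume "\<exists>r<s. [p = tight_weight s t r] (mod (s + t))"
    then obtain r where r: "r < s" and cong: "[p = tight_weight s t r] (mod (s + t))"
      by blast
    have "tight_weight s t r \<le> p"
    proof (rule ccontr)
      assume "\<not> tight_weight s t r \<le> p"
      then have "s + t dvd tight_weight s t r - p" and "0 < tight_weight s t r - p"
        using cong by (simp_all add: cong_altdef_nat cong_sym_eq[of p])
      then have "s + t \<le> tight_weight s t r - p"
        by (rule dvd_imp_le)
      with tight_weight_le_add[OF r, of t] \<open>p > 0\<close> assms(1) show False
        by simp
    qed
    with cong obtain j where "p = tight_weight s t r + j * (s + t)"
      by (metis cong_le_nat add.commute)
    then have "p = tight_weight s t (r + s * j)"
      by (simp add: tight_weight_add_mult assms(1))
    then show "p \<in> range (tight_weight s t)"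
      by blast
  next
    assume "p \<in> range (tight_weight s t)"
    then obtain k where "p = tight_weight s t k"
      by blast
    also have "\<dots> = tight_weight s t (k mod s + s * (k div s))"
      by simp
    also have "\<dots> = tight_weight s t (k mod s) + (k div s) * (s + t)"
      using assms(1) by (rule tight_weight_add_mult)
    finally have "[p = tight_weight s t (k mod s)] (mod (s + t))"
      by (simp add: cong_def)
    then show "\<exists>r<s. [p = tight_weight s t r] (mod (s + t))"
      using assms(1) by (intro exI[of _ "k mod s"]) simp
  qed
  ultimately show ?thesis
    by simp
qed

section \<open>The bijection\<close>

fun pairwise_admissible :: "nat \<Rightarrow> nat \<Rightarrow> nat list \<Rightarrow> bool" where
  "pairwise_admissible s t [] \<longleftrightarrow> True"
| "pairwise_admissible s t [x] \<longleftrightarrow> 0 < x"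
| "pairwise_admissible s t (x # y # c) \<longleftrightarrow>
    0 < y \<and> least_first s t y \<le> x \<and> pairwise_admissible s t c"

lemma pairwise_admissible_iff:
  assumes "s > 0"
  shows "pairwise_admissible s t c \<longleftrightarrow> (\<forall>p\<in>set c. 0 < p) \<and>
    (\<forall>j. 2 * j + 1 < length c \<longrightarrow> s * c ! (2 * j) > t * c ! (2 * j + 1))"
  using assms
proof (induction s t c rule: pairwise_admissible.induct)
  case (3 s t x y c)
  have tail: "(\<forall>j. 2 * j + 1 < length (x # y # c) \<longrightarrow>
        s * (x # y # c) ! (2 * j) > t * (x # y # c) ! (2 * j + 1)) \<longleftrightarrow>
      s * x > t * y \<and> (\<forall>j. 2 * j + 1 < length c \<longrightarrow> s * c ! (2 * j) > t * c ! (2 * j + 1))"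
    (is "(\<forall>j. ?P j) \<longleftrightarrow> ?Q \<and> (\<forall>j. ?R j)")
  proof -
    have "?P 0 \<longleftrightarrow> ?Q" and "?P (Suc j) \<longleftrightarrow> ?R j" for j
      by simp_all
    then show ?thesis
      by (metis not0_implies_Suc)
  qed
  have "0 < x" if "least_first s t y \<le> x"
    using that by (simp add: least_first_def)
  then have "pairwise_admissible s t (x # y # c) \<longleftrightarrow>
      (\<forall>p\<in>set (x # y # c). 0 < p) \<and> t * y < s * x \<and>
      (\<forall>j. 2 * j + 1 < length c \<longrightarrow> s * c ! (2 * j) > t * c ! (2 * j + 1))"
    using 3 by (auto simp: least_first_le_iff)
  then show ?case
    by (simp only: tail)
qed simp_all

lemma A_eq:
  assumes "s > 0"
  shows "A s t n = {c. pairwise_admissible s t c \<and> sum_list c = n}"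
  using assms by (auto simp: A_def compositions_def pairwise_admissible_iff)

fun increment_first :: "nat list \<Rightarrow> nat list" where
  "increment_first [] = [1]"
| "increment_first (x # c) = Suc x # c"

text \<open>
  A composition into weights is given by the list \<open>ks\<close> of their indices, so that the \<open>y\<close> of a
  tight pair can be read off without inverting \<^term>\<open>tight_weight s t\<close>. Index \<open>0\<close> stands for a part
  1; putting it in front raises the first part of whatever follows, or, if nothing follows,
  starts the unpaired last part.
\<close>

fun assemble :: "nat \<Rightarrow> nat \<Rightarrow> nat list \<Rightarrow> nat list" where
  "assemble s t [] = []"
| "assemble s t (k # ks) =
    (if k = 0 then increment_first (assemble s t ks)
     else least_first s t k # k # assemble s t ks)"

fun disassemble :: "nat \<Rightarrow> nat \<Rightarrow> nat list \<Rightarrow> nat list" where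
  "disassemble s t [] = []"
| "disassemble s t [x] = replicate x 0"
| "disassemble s t (x # y # c) = replicate (x - least_first s t y) 0 @ y # disassemble s t c"

lemma sum_list_increment_first [simp]: "sum_list (increment_first c) = Suc (sum_list c)"
  by (cases c) auto

lemma pairwise_admissible_increment_first:
  "pairwise_admissible s t c \<Longrightarrow> pairwise_admissible s t (increment_first c)"
  by (induction s t c rule: pairwise_admissible.induct) auto

lemma disassemble_increment_first:
  "pairwise_admissible s t c \<Longrightarrow> disassemble s t (increment_first c) = 0 # disassemble s t c"
  by (induction s t c rule: pairwise_admissible.induct) (auto simp: Suc_diff_le)

lemma pairwise_admissible_assemble: "pairwise_admissible s t (assemble s t ks)"
  by (induction ks) (auto simp: pairwise_admissible_increment_first)

lemma sum_list_assemble: "sum_list (assemble s t ks) = sum_list (map (tight_weight s t) ks)"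
  by (induction ks) (auto simp: tight_weight_def)

lemma disassemble_assemble: "disassemble s t (assemble s t ks) = ks"
  by (induction ks) (auto simp: disassemble_increment_first pairwise_admissible_assemble)

lemma assemble_replicate_0_append:
  assumes "assemble s t ks = x # c"
  shows "assemble s t (replicate e 0 @ ks) = (e + x) # c"
  using assms by (induction e) auto

lemma assemble_replicate_0: "assemble s t (replicate x 0) = (if x = 0 then [] else [x])"
  by (induction x) auto

lemma assemble_disassemble:
  "pairwise_admissible s t c \<Longrightarrow> assemble s t (disassemble s t c) = c"
proof (induction s t c rule: pairwise_admissible.induct)
  case (3 s t x y c)
  then have "assemble s t (y # disassemble s t c) = least_first s t y # y # c"
    by simp
  then show ?case
    using 3 by (simp add: assemble_replicate_0_append del: assemble.simps)
qed (simp_all add: assemble_replicate_0)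

lemma bij_betw_assemble:
  assumes "s > 0"
  shows "bij_betw (assemble s t) {ks. sum_list (map (tight_weight s t) ks) = n} (A s t n)"
proof (rule bij_betw_byWitness[where f' = "disassemble s t"])
  show "disassemble s t ` A s t n \<subseteq> {ks. sum_list (map (tight_weight s t) ks) = n}"
    using assms by (auto simp: A_eq assemble_disassemble simp flip: sum_list_assemble)
qed (use assms in \<open>auto simp: A_eq disassemble_assemble assemble_disassemble
      pairwise_admissible_assemble sum_list_assemble\<close>)

lemma bij_betw_map_tight_weight:
  "bij_betw (map (tight_weight s t)) {ks. sum_list (map (tight_weight s t) ks) = n}
    {c \<in> compositions n. set c \<subseteq> range (tight_weight s t)}"
proof (rule bij_betw_imageI)
  show "inj_on (map (tight_weight s t)) {ks. sum_list (map (tight_weight s t) ks) = n}"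
    using inj_tight_weight by (blast intro: inj_on_subset inj_mapI)
  have "set c \<subseteq> range (tight_weight s t) \<longleftrightarrow> (\<exists>ks. c = map (tight_weight s t) ks)" for c
    by (auto simp: ex_map_conv)
  then show "map (tight_weight s t) ` {ks. sum_list (map (tight_weight s t) ks) = n} =
      {c \<in> compositions n. set c \<subseteq> range (tight_weight s t)}"
    by (auto simp: compositions_def tight_weight_pos)
qed

theorem theorem1:
  fixes s t n :: nat
  assumes "s > 0" and "t > 0" and "coprime s t" and "n > 0"
  shows "a s t n =
    card {c \<in> compositions n. \<forall>p\<in>set c. \<exists>r<s.
      [int p = int r + \<lceil>(real r * real t + 1) / real s\<rceil>] (mod (int s + int t))}"
proof -
  have "a s t n = card {ks. sum_list (map (tight_weight s t) ks) = n}"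
    unfolding a_def using bij_betw_same_card[OF bij_betw_assemble[OF assms(1)]] by (rule sym)
  also have "\<dots> = card {c \<in> compositions n. set c \<subseteq> range (tight_weight s t)}"
    by (rule bij_betw_same_card[OF bij_betw_map_tight_weight])
  also have "{c \<in> compositions n. set c \<subseteq> range (tight_weight s t)} =
      {c \<in> compositions n. \<forall>p\<in>set c. \<exists>r<s.
        [int p = int r + \<lceil>(real r * real t + 1) / real s\<rceil>] (mod (int s + int t))}"
    using assms(1) by (auto simp: compositions_def cong_iff_range_tight_weight subset_iff)
  finally show ?thesis .
qed

end
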